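(* For every pair of integers $p$ and $k$ with $p$ a prime and $k\geq p$, there exists a graph $G$ with clique number $p$ and chromatic number $k$ such that every induced subgraph of $G$ with clique number $m<p$ has chromatic number at most $\binom{m+2}{3}$.
   Context: Graphs are finite and simple. *)

theory Defs
  imports
    "Graph_Theory.Digraph_Component"
    "HOL-Computational_Algebra.Primes"
begin

text \<open>A finite simple graph is a digraph in the locale \<^locale>\<open>graph\<close>: finitely many vertices and
  arcs, no loops, no parallel arcs, and a symmetric dominance relation, so that an undirected edge
  is a pair of opposite arcs. The definitions below are only meaningful for such digraphs.\<close>

definition is_clique :: "('a, 'b) pre_digraph \<Rightarrow> 'a set \<Rightarrow> bool" where
  "is_clique G C \<longleftrightarrow> C \<subseteq> verts G \<and> (\<forall>u\<in>C. \<forall>v\<in>C. u \<noteq> v \<longrightarrow> u \<rightarrow>\<^bsub>G\<^esub> v)"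

definition clique_number :: "('a, 'b) pre_digraph \<Rightarrow> nat" where
  "clique_number G = Max {card C | C. is_clique G C}"

definition proper_colouring :: "('a, 'b) pre_digraph \<Rightarrow> nat \<Rightarrow> ('a \<Rightarrow> nat) \<Rightarrow> bool" where
  "proper_colouring G n c \<longleftrightarrow>
     (\<forall>v\<in>verts G. c v < n) \<and> (\<forall>u\<in>verts G. \<forall>v\<in>verts G. u \<rightarrow>\<^bsub>G\<^esub> v \<longrightarrow> c u \<noteq> c v)"

definition chromatic_number :: "('a, 'b) pre_digraph \<Rightarrow> nat" where
  "chromatic_number G = (LEAST n. \<exists>c. proper_colouring G n c)"

end

theory Submission
  imports Defs "HOL-Number_Theory.Cong" "HOL-Library.Countable_Set"
begin

text \<open>Take a finite digraph in which all walks with given endpoints have the same length, and join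
  \<open>x\<close> and \<open>y\<close> whenever there is a walk between them whose length is not divisible by \<open>p\<close>.
  A clique \<open>K\<close> of this graph has a vertex \<open>v\<close> that all its vertices reach
  (\<open>clique_has_top\<close>); as lengths add along walks, the lengths of the walks from \<open>K\<close> to \<open>v\<close>
  are pairwise distinct modulo \<open>p\<close> (\<open>inj_on_residues\<close>). So cliques have at most \<open>p\<close>
  vertices, and a walk of length \<open>p - 1\<close> yields a clique with \<open>p\<close> vertices.

  The digraph is Zykov's construction, in the form where each new vertex receives an arc from every
  vertex of a transversal of disjoint pieces. Walk lengths are unique because distinct members of a
  transversal have no common ancestor (\<open>transversal_disjoint\<close>). Every proper colouring makes some
  transversal of \<open>k\<close> vertices rainbow (\<open>rainbow_transversal\<close>), so \<open>k\<close> colours are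
  necessary. Each arc goes to a strictly higher one of \<open>k\<close> layers, so \<open>k\<close> colours suffice, even
  when all vertices joined by a nontrivial walk must differ.

  Now let \<open>U\<close> be a set of vertices whose cliques have at most \<open>m < p\<close> elements. Let \<open>j(v)\<close>
  be the largest size of a clique in \<open>U\<close> with top \<open>v\<close>, and let \<open>I(v)\<close> be the set of residues
  that occur as a walk length to \<open>v\<close> in every such clique of size \<open>j(v)\<close>. If a walk of length \<open>n\<close>
  not divisible by \<open>p\<close> leads from \<open>u\<close> to \<open>v\<close> and \<open>j(u) = j(v)\<close>, then a largest clique at
  \<open>u\<close> cannot be extended by \<open>v\<close>, so it has a vertex at distance \<open>0\<close> modulo \<open>p\<close> from
  \<open>v\<close>; replacing that vertex by \<open>v\<close> gives a largest clique at \<open>v\<close>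
  (\<open>exchange_clique\<close>). Hence \<open>I(v) \<subseteq> I(u) + n\<close>, and if both have the same size, then
  \<open>I(v) = I(u) + n\<close>, which differs from \<open>I(u)\<close> since \<open>p\<close> is prime and
  \<open>0 < card I(u) < p\<close>. Given \<open>i = card I(v)\<close>, at most \<open>i\<close> translates of
  \<open>I(v)\<close> contain \<open>0\<close>, so numbering these translates gives one of \<open>i\<close> positions to
  \<open>I(v)\<close>. Colouring \<open>v\<close> by \<open>j(v)\<close>, \<open>card I(v)\<close> and this position is proper
  (\<open>colour_neq\<close>), and it uses at most \<open>\<Sum>j\<le>m. \<Sum>i\<le>j. i\<close> colours.\<close>

section \<open>Translates of a set of residues\<close>

text \<open>The translate of a set of residues modulo \<open>p\<close>, with residues represented in \<open>{..<p}\<close>.\<close>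

definition shift :: "nat \<Rightarrow> nat \<Rightarrow> nat set \<Rightarrow> nat set" where
  "shift p r A = (\<lambda>a. (a + r) mod p) ` A"

lemma shift_shift: "shift p r (shift p s A) = shift p (s + r) A"
  unfolding shift_def image_image by (simp add: mod_simps add.assoc)

lemma shift_cong: "r mod p = s mod p \<Longrightarrow> shift p r A = shift p s A"
  unfolding shift_def by (metis mod_add_right_eq)

lemma shift_0: "A \<subseteq> {..<p} \<Longrightarrow> shift p 0 A = A"
  unfolding shift_def by (force simp: subset_iff)

lemma inj_on_shift: "inj_on (\<lambda>a. (a + r) mod p) {..<p :: nat}"
proof (rule inj_onI)
  fix a b assume "a \<in> {..<p}" "b \<in> {..<p}" "(a + r) mod p = (b + r) mod p"
  then have "[a + r = b + r] (mod p)" by (simp add: cong_def)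
  then have "[a = b] (mod p)" by (simp add: cong_add_rcancel_nat)
  then show "a = b" using \<open>a \<in> _\<close> \<open>b \<in> _\<close> by (simp add: cong_def)
qed

lemma card_shift: "A \<subseteq> {..<p} \<Longrightarrow> card (shift p r A) = card A"
  unfolding shift_def by (rule card_image) (rule inj_on_subset[OF inj_on_shift])

lemma shift_Inter:
  assumes "\<And>A. A \<in> F \<Longrightarrow> A \<subseteq> {..<p}" "F \<noteq> {}"
  shows "shift p r (\<Inter>F) = (\<Inter>A\<in>F. shift p r A)"
proof -
  obtain A where "A \<in> F" using assms(2) by auto
  then show ?thesis
    using image_INT[OF inj_on_shift[of r p], of F id A] assms(1) unfolding shift_def by simp
qed

lemma shift_neq:
  assumes "prime p" "\<not> p dvd r" "A \<noteq> {}" "A \<subseteq> {..<p}" "card A < p"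
  shows "shift p r A \<noteq> A"
proof
  assume fixed: "shift p r A = A"
  have iter: "shift p (k * r) A = A" for k
  proof (induction k)
    case 0
    then show ?case using shift_0[OF assms(4)] by simp
  next
    case (Suc k)
    then show ?case using fixed shift_shift[of p r "k * r" A] by (simp add: add.commute)
  qed
  obtain a where a: "a \<in> A" using assms(3) by auto
  \<comment> \<open>Multiples of \<open>r\<close> lead from \<open>a\<close> to every residue, so \<open>A\<close> contains all of them.\<close>
  have "coprime r p"
    using assms(1,2) prime_imp_coprime coprime_commute by blast
  then obtain s where s: "[r * s = 1] (mod p)"
    using cong_solve_coprime_nat by (metis One_nat_def)
  have "{..<p} \<subseteq> A"
  proof
    fix b assume b: "b \<in> {..<p}"
    have "a < p" using a assms(4) by auto
    define d where "d = b + (p - a)"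
    have "[a + (s * d) * r = a + 1 * d] (mod p)"
      using cong_add[OF cong_refl cong_mult[OF s cong_refl[of d]]] by (simp add: mult_ac)
    also have "a + 1 * d = b + p" using \<open>a < p\<close> by (simp add: d_def)
    finally have "(a + (s * d) * r) mod p = b"
      using b by (simp add: cong_def)
    then have "b \<in> shift p ((s * d) * r) A"
      unfolding shift_def using a by (metis imageI)
    then show "b \<in> A" using iter by simp
  qed
  then have "p \<le> card A"
    using assms(4) by (metis card_lessThan order_refl subset_antisym)
  then show False using assms(5) by simp
qed

text \<open>The translates of \<open>A\<close> that contain \<open>0\<close>. There are at most \<open>card A\<close> of them, since each
  is obtained by moving some element of \<open>A\<close> to \<open>0\<close>.\<close>

definition orbit0 :: "nat \<Rightarrow> nat set \<Rightarrow> nat set set" where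
  "orbit0 p A = {B. 0 \<in> B \<and> (\<exists>r. B = shift p r A)}"

lemma orbit0_subset:
  assumes "A \<subseteq> {..<p}"
  shows "orbit0 p A \<subseteq> (\<lambda>a. shift p (p - a) A) ` A"
proof
  fix B assume "B \<in> orbit0 p A"
  then obtain r a where B: "B = shift p r A" and a: "a \<in> A" "(a + r) mod p = 0"
    unfolding orbit0_def shift_def by force
  have "a < p" using a assms by auto
  have "[a + r = a + (p - a)] (mod p)"
    using a(2) \<open>a < p\<close> by (simp add: cong_def)
  then have "r mod p = (p - a) mod p"
    unfolding cong_add_lcancel_nat by (simp add: cong_def)
  then show "B \<in> (\<lambda>a. shift p (p - a) A) ` A"
    using a(1) B shift_cong by blast
qed

lemma finite_orbit0:
  assumes "A \<subseteq> {..<p}"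
  shows "finite (orbit0 p A)"
  using orbit0_subset[OF assms] finite_subset[OF assms] by (meson finite_imageI finite_lessThan finite_subset)

lemma card_orbit0_le:
  assumes "A \<subseteq> {..<p}"
  shows "card (orbit0 p A) \<le> card A"
  using surj_card_le[OF _ orbit0_subset[OF assms]] finite_subset[OF assms] by simp

lemma orbit0_shift:
  assumes "p > 0"
  shows "orbit0 p (shift p r A) = orbit0 p A"
proof -
  have "\<exists>s'. shift p s A = shift p (r + s') A" for s
  proof
    \<comment> \<open>\<open>r * (p - 1)\<close> is the additive inverse of \<open>r\<close> modulo \<open>p\<close>.\<close>
    show "shift p s A = shift p (r + (s + r * (p - 1))) A"
    proof (rule shift_cong)
      show "s mod p = (r + (s + r * (p - 1))) mod p"
      proof (cases p)
        case (Suc q)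
        then have "r + (s + r * (p - 1)) = s + r * p" by (simp add: algebra_simps)
        then show ?thesis by (metis mod_mult_self1)
      qed (use assms in simp)
    qed
  qed
  then have "(\<exists>s'. B = shift p (r + s') A) \<longleftrightarrow> (\<exists>s. B = shift p s A)" for B by metis
  then show ?thesis unfolding orbit0_def shift_shift by simp
qed

text \<open>The number of \<open>A\<close> in an enumeration of the translates of \<open>A\<close> that contain \<open>0\<close>. The
  enumeration depends on this family only, so it is shared by all translates of \<open>A\<close>.\<close>

definition pos :: "nat \<Rightarrow> nat set \<Rightarrow> nat" where
  "pos p A = to_nat_on (orbit0 p A) A"

lemma orbit0_self: "A \<subseteq> {..<p} \<Longrightarrow> 0 \<in> A \<Longrightarrow> A \<in> orbit0 p A"
  unfolding orbit0_def using shift_0 by blast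

lemma pos_less:
  assumes "A \<subseteq> {..<p}" "0 \<in> A"
  shows "pos p A < card A"
proof -
  have "pos p A \<in> {..<card (orbit0 p A)}"
    unfolding pos_def using bij_betwE[OF to_nat_on_finite[OF finite_orbit0[OF assms(1)]]]
      orbit0_self[OF assms] by blast
  then show ?thesis using card_orbit0_le[OF assms(1)] by simp
qed

lemma pos_shift_neq:
  assumes "prime p" "\<not> p dvd r" "A \<subseteq> {..<p}" "card A < p" "0 \<in> A" "0 \<in> shift p r A"
  shows "pos p (shift p r A) \<noteq> pos p A"
proof -
  have "shift p r A \<noteq> A" using shift_neq assms by blast
  moreover have "shift p r A \<in> orbit0 p A" unfolding orbit0_def using assms(6) by blast
  moreover have "inj_on (to_nat_on (orbit0 p A)) (orbit0 p A)"
    using to_nat_on_finite[OF finite_orbit0[OF assms(3)]] by (rule bij_betw_imp_inj_on)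
  ultimately show ?thesis
    using orbit0_self[OF assms(3,5)] unfolding pos_def orbit0_shift[OF prime_gt_0_nat[OF assms(1)]]
    by (metis inj_on_contraD)
qed

section \<open>Digraphs whose walk lengths are determined by their endpoints\<close>

locale walk_length =
  fixes E :: "'a rel"
  assumes walk_unique: "(x, y) \<in> E ^^ m \<Longrightarrow> (x, y) \<in> E ^^ n \<Longrightarrow> m = n"
begin

text \<open>The length of the walks from \<open>x\<close> to \<open>y\<close>; it is only meaningful if there is such a walk.\<close>

definition len :: "'a \<Rightarrow> 'a \<Rightarrow> nat" where
  "len x y = (THE n. (x, y) \<in> E ^^ n)"

text \<open>The graph under study: a walk whose length is not divisible by \<open>p\<close> connects \<open>x\<close> and \<open>y\<close>,
  in either direction.\<close>

definition adj :: "nat \<Rightarrow> 'a \<Rightarrow> 'a \<Rightarrow> bool" where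
  "adj p x y \<longleftrightarrow> (\<exists>n. \<not> p dvd n \<and> ((x, y) \<in> E ^^ n \<or> (y, x) \<in> E ^^ n))"

lemma len_eq: "(x, y) \<in> E ^^ n \<Longrightarrow> len x y = n"
  unfolding len_def using walk_unique by blast

lemma len_refl [simp]: "len x x = 0"
  by (rule len_eq) simp

lemma walk_len: "(x, y) \<in> E\<^sup>* \<Longrightarrow> (x, y) \<in> E ^^ len x y"
  using len_eq rtrancl_imp_relpow by fastforce

lemma len_add:
  assumes "(x, y) \<in> E\<^sup>*" "(y, z) \<in> E\<^sup>*"
  shows "len x z = len x y + len y z"
  by (rule len_eq) (use walk_len[OF assms(1)] walk_len[OF assms(2)] in \<open>auto simp: relpow_add\<close>)

lemma adj_iff:
  "adj p x y \<longleftrightarrow>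
     (x, y) \<in> E\<^sup>* \<and> \<not> p dvd len x y \<or> (y, x) \<in> E\<^sup>* \<and> \<not> p dvd len y x"
  unfolding adj_def using len_eq walk_len by (metis relpow_imp_rtrancl)

lemma adj_sym: "adj p x y \<longleftrightarrow> adj p y x"
  unfolding adj_def by blast

lemma adj_irrefl: "\<not> adj p x x"
  unfolding adj_iff by simp

text \<open>The cliques inside \<open>U\<close> with top \<open>v\<close>: they contain \<open>v\<close>, and each of their vertices has a
  walk to \<open>v\<close>.\<close>

definition cliques_to :: "nat \<Rightarrow> 'a set \<Rightarrow> 'a \<Rightarrow> 'a set set" where
  "cliques_to p U v = {K. K \<subseteq> U \<and> v \<in> K \<and> pairwise (adj p) K \<and> (\<forall>x\<in>K. (x, v) \<in> E\<^sup>*)}"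

text \<open>The lengths modulo \<open>p\<close> of the walks from the vertices of \<open>K\<close> to \<open>v\<close>.\<close>

definition residues_to :: "nat \<Rightarrow> 'a \<Rightarrow> 'a set \<Rightarrow> nat set" where
  "residues_to p v K = (\<lambda>x. len x v mod p) ` K"

lemma residues_neq:
  assumes "adj p x y" "(x, v) \<in> E\<^sup>*" "(y, v) \<in> E\<^sup>*"
  shows "len x v mod p \<noteq> len y v mod p"
proof -
  have *: "len x v mod p \<noteq> len y v mod p"
    if "(x, y) \<in> E\<^sup>*" "\<not> p dvd len x y" "(y, v) \<in> E\<^sup>*" for x y
  proof
    assume "len x v mod p = len y v mod p"
    then have "[len x y + len y v = len y v] (mod p)"
      using len_add[OF that(1,3)] by (simp add: cong_def)
    then show False
      using that(2) by (simp add: cong_add_rcancel_0_nat cong_0_iff)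
  qed
  show ?thesis using assms(1) *[of x y] *[of y x] assms(2,3) unfolding adj_iff by metis
qed

lemma inj_on_residues:
  assumes "K \<in> cliques_to p U v"
  shows "inj_on (\<lambda>x. len x v mod p) K"
proof (rule inj_onI, rule ccontr)
  fix x y assume "x \<in> K" "y \<in> K" and eq: "len x v mod p = len y v mod p" and "x \<noteq> y"
  then have "adj p x y" "(x, v) \<in> E\<^sup>*" "(y, v) \<in> E\<^sup>*"
    using assms unfolding cliques_to_def pairwise_def by auto
  then show False using residues_neq eq by blast
qed

lemma card_residues_to: "K \<in> cliques_to p U v \<Longrightarrow> card (residues_to p v K) = card K"
  unfolding residues_to_def by (rule card_image) (rule inj_on_residues)

lemma clique_has_top:
  assumes "finite K" "K \<noteq> {}" "pairwise (adj p) K"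
  obtains v where "K \<in> cliques_to p K v"
proof -
  \<comment> \<open>A vertex reached by the largest number of vertices of \<open>K\<close> is reached by all of them.\<close>
  define below where "below v = {x \<in> K. (x, v) \<in> E\<^sup>*}" for v
  obtain v where v: "v \<in> K" "\<And>y. y \<in> K \<Longrightarrow> card (below y) \<le> card (below v)"
    using finite_imageI[OF assms(1), of "card \<circ> below"] assms(2)
      Max_in[of "(card \<circ> below) ` K"] Max_ge[of "(card \<circ> below) ` K"]
    by (smt (verit, best) comp_apply image_iff image_is_empty)
  have "(y, v) \<in> E\<^sup>*" if y: "y \<in> K" for y
  proof (rule ccontr)
    assume no: "(y, v) \<notin> E\<^sup>*"
    then have "(v, y) \<in> E\<^sup>*"
      using assms(3) v(1) y unfolding pairwise_def adj_iff by (metis rtrancl.rtrancl_refl)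
    then have "below v \<subset> below y"
      using no y unfolding below_def by (auto intro: rtrancl_trans)
    then have "card (below v) < card (below y)"
      by (rule psubset_card_mono[rotated]) (use assms(1) in \<open>simp add: below_def\<close>)
    then show False using v(2)[OF y] by simp
  qed
  then show ?thesis
    using that[of v] v(1) assms(3) unfolding cliques_to_def by simp
qed

lemma card_clique_le:
  assumes "finite K" "pairwise (adj p) K" "p > 0"
  shows "card K \<le> p"
proof (cases "K = {}")
  case False
  then obtain v where v: "K \<in> cliques_to p K v" using clique_has_top assms by blast
  have "residues_to p v K \<subseteq> {..<p}" unfolding residues_to_def using assms(3) by auto
  then show ?thesis
    using card_residues_to[OF v] card_mono[of "{..<p}"] by (metis card_lessThan finite_lessThan)
qed simp

lemma walk_clique:
  assumes "(x, y) \<in> E ^^ (p - 1)" "p > 0"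
  obtains K where "finite K" "card K = p" "pairwise (adj p) K" "\<forall>z\<in>K. (z, y) \<in> E\<^sup>*"
proof -
  obtain f where f: "f 0 = x" "f (p - 1) = y" "\<And>i. i < p - 1 \<Longrightarrow> (f i, f (Suc i)) \<in> E"
    using assms(1) unfolding relpow_fun_conv by blast
  have walk: "(f i, f (i + d)) \<in> E ^^ d" if "i + d < p" for i d
    using that
  proof (induction d)
    case (Suc d)
    then show ?case using f(3)[of "i + d"] by auto
  qed simp
  have adj: "adj p (f i) (f j)" if "i < j" "j < p" for i j
    unfolding adj_def
  proof (intro exI conjI disjI1)
    show "(f i, f j) \<in> E ^^ (j - i)" using walk[of i "j - i"] that by simp
    show "\<not> p dvd j - i" using that by (auto dest: dvd_imp_le)
  qed
  have inj: "inj_on f {..<p}"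
    by (rule linorder_inj_onI) (use adj adj_irrefl in \<open>auto, metis\<close>)
  have "pairwise (adj p) (f ` {..<p})"
    unfolding pairwise_def using adj adj_sym by (auto, metis linorder_neqE_nat)
  moreover have "(f i, y) \<in> E\<^sup>*" if "i < p" for i
    using walk[of i "p - 1 - i"] that f(2) by (simp add: relpow_imp_rtrancl)
  ultimately show ?thesis
    using that[of "f ` {..<p}"] card_image[OF inj] by simp
qed

end

section \<open>Few colours for induced subgraphs of small clique number\<close>

context walk_length
begin

text \<open>A clique with top \<open>u\<close> that is at least as large as every clique with top \<open>v\<close> cannot be
  extended by \<open>v\<close>, so exactly one of its vertices is at a distance divisible by \<open>p\<close> from \<open>v\<close>;
  that vertex is exchanged for \<open>v\<close>, which has distance \<open>0\<close>.\<close>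

lemma exchange_clique:
  assumes "K \<in> cliques_to p U u" "v \<in> U" "(u, v) \<in> E ^^ n" "\<not> p dvd n" "finite K"
    and max: "\<And>K'. K' \<in> cliques_to p U v \<Longrightarrow> card K' \<le> card K"
  obtains K' where "K' \<in> cliques_to p U v" "card K' = card K"
    "residues_to p v K' = shift p n (residues_to p u K)"
proof -
  have KU: "K \<subseteq> U" and cl: "pairwise (adj p) K" and u: "u \<in> K"
    and reach: "\<And>x. x \<in> K \<Longrightarrow> (x, u) \<in> E\<^sup>*"
    using assms(1) unfolding cliques_to_def by auto
  have uv: "(u, v) \<in> E\<^sup>*" using assms(3) by (rule relpow_imp_rtrancl)
  have reach_v: "(x, v) \<in> E\<^sup>*" if "x \<in> K" for x
    using reach[OF that] uv by simp
  have len_v: "len x v = len x u + n" if "x \<in> K" for x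
    using len_add[OF reach[OF that] uv] len_eq[OF assms(3)] by simp
  have adj_v: "adj p x v" if "x \<in> K" "\<not> p dvd len x v" for x
    using reach_v[OF that(1)] that(2) unfolding adj_iff by simp
  have "\<exists>x\<in>K. p dvd len x v"
  proof (rule ccontr)
    assume none: "\<not> (\<exists>x\<in>K. p dvd len x v)"
    then have "v \<notin> K" by force
    have "insert v K \<in> cliques_to p U v"
      using KU cl assms(2) reach_v adj_v none adj_sym[of p v]
      unfolding cliques_to_def by (auto simp: pairwise_insert)
    then have "card (insert v K) \<le> card K" by (rule max)
    then show False using \<open>v \<notin> K\<close> assms(5) by simp
  qed
  then obtain z where z: "z \<in> K" "p dvd len z v" by blast
  have inj: "x = z" if "x \<in> K" "p dvd len x v" for x
  proof (rule ccontr)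
    assume "x \<noteq> z"
    then have "adj p x z" using that(1) z(1) cl unfolding pairwise_def by simp
    then have "len x v mod p \<noteq> len z v mod p"
      using residues_neq reach_v that(1) z(1) by blast
    then show False using that(2) z(2) by simp
  qed
  define K' where "K' = insert v (K - {z})"
  have v: "v \<notin> K - {z}" using inj[of v] by auto
  have "adj p x v \<and> adj p v x" if "x \<in> K - {z}" for x
    using that adj_v inj adj_sym[of p v] by auto
  moreover have "pairwise (adj p) (K - {z})" using cl by (rule pairwise_subset) auto
  ultimately have "K' \<in> cliques_to p U v"
    using KU assms(2) reach_v unfolding K'_def cliques_to_def by (auto simp: pairwise_insert)
  moreover have "card K' = card K"
    unfolding K'_def using v z(1) assms(5) card_Suc_Diff1[OF assms(5) z(1)] by simp
  moreover have "residues_to p v K' = shift p n (residues_to p u K)"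
  proof -
    have "len z v mod p = len v v mod p" using z(2) by simp
    then have "residues_to p v K' = (\<lambda>x. len x v mod p) ` insert z (K - {z})"
      unfolding residues_to_def K'_def image_insert by (rule arg_cong2[where f = insert, OF sym refl])
    also have "\<dots> = (\<lambda>x. (len x u + n) mod p) ` K"
      using z(1) len_v by (simp add: insert_absorb)
    also have "\<dots> = shift p n (residues_to p u K)"
      unfolding shift_def residues_to_def image_image by (simp add: mod_simps)
    finally show ?thesis .
  qed
  ultimately show ?thesis using that by blast
qed

text \<open>The largest size of a clique inside \<open>U\<close> with top \<open>v\<close>.\<close>

definition level :: "nat \<Rightarrow> 'a set \<Rightarrow> 'a \<Rightarrow> nat" where
  "level p U v = Max (card ` cliques_to p U v)"

text \<open>The residues that occur in every largest clique with top \<open>v\<close>.\<close>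

definition common_residues :: "nat \<Rightarrow> 'a set \<Rightarrow> 'a \<Rightarrow> nat set" where
  "common_residues p U v =
     (\<Inter>K\<in>{K \<in> cliques_to p U v. card K = level p U v}. residues_to p v K)"

lemma finite_cliques_to: "finite U \<Longrightarrow> finite (cliques_to p U v)"
  unfolding cliques_to_def by simp

lemma cliques_to_singleton: "v \<in> U \<Longrightarrow> {v} \<in> cliques_to p U v"
  unfolding cliques_to_def by simp

lemma card_le_level: "finite U \<Longrightarrow> K \<in> cliques_to p U v \<Longrightarrow> card K \<le> level p U v"
  unfolding level_def by (rule Max_ge) (simp_all add: finite_cliques_to)

lemma level_attained:
  assumes "finite U" "v \<in> U"
  obtains K where "K \<in> cliques_to p U v" "card K = level p U v"
proof -
  have "Max (card ` cliques_to p U v) \<in> card ` cliques_to p U v"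
    by (rule Max_in) (use assms finite_cliques_to cliques_to_singleton in blast)+
  then show ?thesis using that unfolding level_def by force
qed

lemma residues_to_subset: "p > 0 \<Longrightarrow> residues_to p v K \<subseteq> {..<p}"
  unfolding residues_to_def by auto

lemma common_residues_subset:
  assumes "finite U" "v \<in> U" "p > 0"
  shows "common_residues p U v \<subseteq> {..<p}"
proof -
  obtain K where "K \<in> cliques_to p U v" "card K = level p U v"
    using level_attained[OF assms(1,2)] by blast
  then have "common_residues p U v \<subseteq> residues_to p v K"
    unfolding common_residues_def by blast
  then show ?thesis using residues_to_subset[OF assms(3)] by blast
qed

lemma zero_in_common_residues: "0 \<in> common_residues p U v"
proof -
  have "0 \<in> residues_to p v K" if "K \<in> cliques_to p U v" for K
  proof -
    have "v \<in> K" using that unfolding cliques_to_def by simp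
    then have "len v v mod p \<in> residues_to p v K" unfolding residues_to_def by (rule imageI)
    then show ?thesis by simp
  qed
  then show ?thesis unfolding common_residues_def by simp
qed

lemma card_common_residues_le:
  assumes "finite U" "v \<in> U" "p > 0"
  shows "card (common_residues p U v) \<le> level p U v"
proof -
  obtain K where K: "K \<in> cliques_to p U v" "card K = level p U v"
    using level_attained[OF assms(1,2)] by blast
  then have "common_residues p U v \<subseteq> residues_to p v K"
    unfolding common_residues_def by blast
  then have "card (common_residues p U v) \<le> card (residues_to p v K)"
    using residues_to_subset[OF assms(3)] by (meson card_mono finite_lessThan finite_subset)
  then show ?thesis using card_residues_to[OF K(1)] K(2) by simp
qed

lemma common_residues_step:
  assumes "finite U" "u \<in> U" "v \<in> U" "(u, v) \<in> E ^^ n" "\<not> p dvd n" "p > 0"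
    and level: "level p U u = level p U v"
  shows "common_residues p U v \<subseteq> shift p n (common_residues p U u)"
proof -
  define M where "M w = {K \<in> cliques_to p U w. card K = level p U w}" for w
  have "common_residues p U v \<subseteq> shift p n (residues_to p u K)" if K: "K \<in> M u" for K
  proof -
    have "K \<in> cliques_to p U u" "card K = level p U v" using K level unfolding M_def by auto
    moreover from this have "finite K"
      using assms(1) finite_subset unfolding cliques_to_def by blast
    ultimately obtain K' where "K' \<in> cliques_to p U v" "card K' = card K"
      "residues_to p v K' = shift p n (residues_to p u K)"
      using exchange_clique[of K p U u v n] card_le_level[OF assms(1)] assms(3-5) by metis
    then show ?thesis
      using \<open>card K = level p U v\<close> unfolding common_residues_def by auto
  qed
  moreover have "shift p n (common_residues p U u)
      = (\<Inter>A\<in>residues_to p u ` M u. shift p n A)"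
    unfolding common_residues_def M_def
  proof (rule shift_Inter)
    show "residues_to p u ` {K \<in> cliques_to p U u. card K = level p U u} \<noteq> {}"
      using level_attained[OF assms(1,2)] by blast
  qed (use residues_to_subset[OF assms(6)] in blast)
  ultimately show ?thesis by auto
qed

text \<open>The third component is smaller than the second one, which is at most the first one.\<close>

definition colour :: "nat \<Rightarrow> 'a set \<Rightarrow> 'a \<Rightarrow> nat \<times> nat \<times> nat" where
  "colour p U v =
     (level p U v, card (common_residues p U v), pos p (common_residues p U v))"

lemma colour_neq:
  assumes "prime p" "finite U" "u \<in> U" "v \<in> U" "adj p u v"
    and small: "\<And>K. K \<subseteq> U \<Longrightarrow> pairwise (adj p) K \<Longrightarrow> card K < p"
  shows "colour p U u \<noteq> colour p U v"
proof -
  have p: "p > 0" using assms(1) prime_gt_0_nat by blast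
  have *: "colour p U u \<noteq> colour p U v"
    if uv: "u \<in> U" "v \<in> U" "(u, v) \<in> E ^^ n" "\<not> p dvd n" for u v n
  proof
    assume eq: "colour p U u = colour p U v"
    let ?I = "common_residues p U u" and ?J = "common_residues p U v"
    have sub: "?J \<subseteq> shift p n ?I"
      using common_residues_step[OF assms(2) uv p] eq unfolding colour_def by simp
    have I: "?I \<subseteq> {..<p}" using common_residues_subset[OF assms(2) uv(1) p] .
    have "card ?J = card (shift p n ?I)"
      using card_shift[OF I] eq unfolding colour_def by simp
    moreover have "finite (shift p n ?I)"
      unfolding shift_def using I finite_subset by blast
    ultimately have J: "?J = shift p n ?I" using sub card_subset_eq by blast
    obtain K where "K \<in> cliques_to p U u" "card K = level p U u"
      using level_attained[OF assms(2) uv(1)] by blast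
    then have "level p U u < p" using small[of K] unfolding cliques_to_def by simp
    then have "card ?I < p" using card_common_residues_le[OF assms(2) uv(1) p] by linarith
    then have "pos p ?J \<noteq> pos p ?I"
      unfolding J using zero_in_common_residues[of p U u] zero_in_common_residues[of p U v] J
      by (intro pos_shift_neq[OF assms(1) uv(4) I]) simp_all
    then show False using eq unfolding colour_def by simp
  qed
  show ?thesis using assms(3-5) *[of u v] *[of v u] unfolding adj_def by metis
qed

end

lemma sum_triangular: "(\<Sum>j=1..m. \<Sum>i=1..j. i) = (m + 2) choose 3"
proof -
  have *: "\<Sum>{1..j} = Suc j choose 2" for j :: nat
    by (induction j) (simp_all add: numeral_eq_Suc)
  have "(\<Sum>j=1..m. Suc j choose 2) = (m + 2) choose 3"
    by (induction m) (simp_all add: numeral_eq_Suc)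
  then show ?thesis unfolding * .
qed

lemma (in walk_length) colouring_of_small_clique_number:
  assumes "prime p" "m < p" "finite U"
    and cliques: "\<And>K. K \<subseteq> U \<Longrightarrow> pairwise (adj p) K \<Longrightarrow> card K \<le> m"
  obtains c :: "'a \<Rightarrow> nat" where "\<And>v. v \<in> U \<Longrightarrow> c v < (m + 2) choose 3"
    "\<And>u v. u \<in> U \<Longrightarrow> v \<in> U \<Longrightarrow> adj p u v \<Longrightarrow> c u \<noteq> c v"
proof -
  have p: "p > 0" using assms(2) by simp
  define T where "T = (SIGMA j:{1..m}. SIGMA i:{1..j}. {..<i})"
  have fin: "finite T" and card: "card T = (m + 2) choose 3"
    unfolding T_def using sum_triangular[of m] by simp_all
  have in_T: "colour p U v \<in> T" if v: "v \<in> U" for v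
  proof -
    let ?I = "common_residues p U v"
    obtain K where "K \<in> cliques_to p U v" "card K = level p U v"
      using level_attained[OF assms(3) v] by blast
    then have "level p U v \<le> m" using cliques[of K] unfolding cliques_to_def by simp
    moreover have "card ?I \<le> level p U v" using card_common_residues_le[OF assms(3) v p] .
    moreover have "pos p ?I < card ?I"
      using pos_less[OF common_residues_subset[OF assms(3) v p] zero_in_common_residues] .
    ultimately show ?thesis unfolding colour_def T_def by simp
  qed
  define c where "c v = to_nat_on T (colour p U v)" for v
  have bij: "bij_betw (to_nat_on T) T {..<(m + 2) choose 3}"
    using to_nat_on_finite[OF fin] card by simp
  show ?thesis
  proof
    show "c v < (m + 2) choose 3" if "v \<in> U" for v
      using bij_betwE[OF bij] in_T[OF that] unfolding c_def by blast
    show "c u \<noteq> c v" if uv: "u \<in> U" "v \<in> U" "adj p u v" for u v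
    proof -
      have "colour p U u \<noteq> colour p U v"
        using colour_neq[OF assms(1,3) uv] cliques assms(2) le_less_trans by blast
      then show ?thesis
        using bij_betw_imp_inj_on[OF bij] in_T[OF uv(1)] in_T[OF uv(2)]
        unfolding c_def inj_on_def by blast
    qed
  qed
qed

section \<open>Zykov digraphs\<close>

text \<open>One step of the construction takes two disjoint copies of the previous digraph, made by
  \<open>Keep\<close> and \<open>Copy\<close>, and adds for each of its transversals \<open>T\<close> a vertex \<open>Apex T\<close> that
  receives an arc from the members of \<open>T\<close> in the second copy. As \<open>Apex []\<close> is a vertex without
  incoming arcs, the construction can start from the empty digraph.\<close>

datatype zvertex = Keep zvertex | Copy zvertex | Apex "zvertex list"

instance zvertex :: countable
  by countable_datatype

inductive_set zarc :: "zvertex rel" where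
  Keep: "(x, y) \<in> zarc \<Longrightarrow> (Keep x, Keep y) \<in> zarc"
| Copy: "(x, y) \<in> zarc \<Longrightarrow> (Copy x, Copy y) \<in> zarc"
| Apex: "t \<in> set T \<Longrightarrow> (Copy t, Apex T) \<in> zarc"

text \<open>The transversals after \<open>k\<close> steps. The digraph after \<open>Suc k\<close> steps consists of the
  \<open>Keep\<close> copy of the previous one and of the new part, made of its \<open>Copy\<close> copy and the apices;
  a transversal extends one of the \<open>Keep\<close> copy by a vertex of the new part. Every vertex lies in
  some transversal, so the vertex set is the union of the transversals.\<close>

primrec transversals :: "nat \<Rightarrow> zvertex list set" where
  "transversals 0 = {[]}"
| "transversals (Suc k) =
     (\<lambda>(y, T). y # map Keep T) `
       ((Copy ` (\<Union>T\<in>transversals k. set T) \<union> Apex ` transversals k) \<times> transversals k)"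

definition zverts :: "nat \<Rightarrow> zvertex set" where
  "zverts k = (\<Union>T\<in>transversals k. set T)"

text \<open>The part that step \<open>Suc k\<close> adds to the \<open>Keep\<close> copy.\<close>

definition znew :: "nat \<Rightarrow> zvertex set" where
  "znew k = Copy ` zverts k \<union> Apex ` transversals k"

lemma transversals_Suc:
  "transversals (Suc k) = (\<lambda>(y, T). y # map Keep T) ` (znew k \<times> transversals k)"
  unfolding znew_def zverts_def by simp

declare transversals.simps(2) [simp del]

lemma transversals_nonempty: "transversals k \<noteq> {}"
  by (induction k) (auto simp: transversals_Suc znew_def)

lemma zverts_0 [simp]: "zverts 0 = {}"
  unfolding zverts_def by simp

lemma zverts_Suc: "zverts (Suc k) = Keep ` zverts k \<union> znew k"
proof -
  have "znew k \<noteq> {}" unfolding znew_def using transversals_nonempty by blast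
  then show ?thesis
    using transversals_nonempty[of k] unfolding zverts_def transversals_Suc by fastforce
qed

lemma finite_transversals: "finite (transversals k)"
  by (induction k) (auto simp: transversals_Suc znew_def zverts_def)

lemma finite_zverts: "finite (zverts k)"
  unfolding zverts_def using finite_transversals by blast

lemma transversal_subset: "T \<in> transversals k \<Longrightarrow> set T \<subseteq> zverts k"
  unfolding zverts_def by blast

lemma length_transversal: "T \<in> transversals k \<Longrightarrow> length T = k"
  by (induction k arbitrary: T) (auto simp: transversals_Suc)

lemma zarc_into_Keep: "(x, Keep y) \<in> zarc \<longleftrightarrow> (\<exists>x'. x = Keep x' \<and> (x', y) \<in> zarc)"
  by (auto elim: zarc.cases intro: zarc.intros)

lemma zarc_into_Copy: "(x, Copy y) \<in> zarc \<longleftrightarrow> (\<exists>x'. x = Copy x' \<and> (x', y) \<in> zarc)"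
  by (auto elim: zarc.cases intro: zarc.intros)

lemma zarc_into_Apex: "(x, Apex T) \<in> zarc \<longleftrightarrow> (\<exists>t\<in>set T. x = Copy t)"
  by (auto elim: zarc.cases intro: zarc.intros)

lemma zwalk_into_Keep:
  "(x, Keep y) \<in> zarc ^^ n \<longleftrightarrow> (\<exists>x'. x = Keep x' \<and> (x', y) \<in> zarc ^^ n)"
  by (induction n arbitrary: y) (auto simp: zarc_into_Keep relcomp_unfold, metis)

lemma zwalk_into_Copy:
  "(x, Copy y) \<in> zarc ^^ n \<longleftrightarrow> (\<exists>x'. x = Copy x' \<and> (x', y) \<in> zarc ^^ n)"
  by (induction n arbitrary: y) (auto simp: zarc_into_Copy relcomp_unfold, metis)

lemma zwalk_into_Apex:
  "(x, Apex T) \<in> zarc ^^ Suc n \<longleftrightarrow> (\<exists>t\<in>set T. \<exists>x'. x = Copy x' \<and> (x', t) \<in> zarc ^^ n)"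
proof -
  have "(x, Apex T) \<in> zarc ^^ Suc n \<longleftrightarrow> (\<exists>t\<in>set T. (x, Copy t) \<in> zarc ^^ n)"
    by (auto simp: zarc_into_Apex relcomp_unfold)
  then show ?thesis unfolding zwalk_into_Copy .
qed

lemma zverts_closed: "(x, y) \<in> zarc \<Longrightarrow> y \<in> zverts k \<Longrightarrow> x \<in> zverts k"
proof (induction k arbitrary: x y)
  case (Suc k)
  then show ?case
    unfolding zverts_Suc znew_def
    by (fastforce simp: zarc_into_Keep zarc_into_Copy zarc_into_Apex dest: transversal_subset)
qed simp

text \<open>The members of a transversal have pairwise disjoint sets of ancestors.\<close>

lemma transversal_disjoint:
  assumes "T \<in> transversals k" "t \<in> set T" "t' \<in> set T"
    and "(x, t) \<in> zarc ^^ m" "(x, t') \<in> zarc ^^ n"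
  shows "t = t'"
  using assms
proof (induction k arbitrary: T t t' x m n)
  case (Suc k)
  have new: "x \<in> range Copy \<union> range Apex" if "(x, y) \<in> zarc ^^ n" "y \<in> znew k" for x y n
    using that by (cases n) (auto simp: znew_def zwalk_into_Copy zwalk_into_Apex simp del: relpow.simps(2))
  have keep: "\<exists>x'. x = Keep x' \<and> (x', y) \<in> zarc ^^ n" if "(x, Keep y) \<in> zarc ^^ n" for x y n
    using that by (simp add: zwalk_into_Keep)
  obtain y S where T: "T = y # map Keep S" and y: "y \<in> znew k" and S: "S \<in> transversals k"
    using Suc.prems(1) unfolding transversals_Suc by auto
  have set_T: "set T = insert y (Keep ` set S)" unfolding T by simp
  consider "t = y" "t' = y" | s where "t = y" "t' = Keep s" | s where "t = Keep s" "t' = y"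
    | s s' where "t = Keep s" "t' = Keep s'" "s \<in> set S" "s' \<in> set S"
    using Suc.prems(2,3) unfolding set_T by blast
  then show ?case
  proof cases
    case 4
    then show ?thesis
      using Suc.prems(4,5) Suc.IH[OF S 4(3,4)] by (auto simp: zwalk_into_Keep)
  qed (use Suc.prems(4,5) new[OF _ y] in \<open>fastforce simp: zwalk_into_Keep\<close>)+
qed simp

lemma zwalk_unique:
  assumes "y \<in> zverts k" "(x, y) \<in> zarc ^^ m" "(x, y) \<in> zarc ^^ n"
  shows "m = n"
  using assms
proof (induction k arbitrary: x y m n)
  case (Suc k)
  from Suc.prems(1) consider
      (Keep) z where "y = Keep z" "z \<in> zverts k"
    | (Copy) z where "y = Copy z" "z \<in> zverts k"
    | (Apex) T where "y = Apex T" "T \<in> transversals k"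
    unfolding zverts_Suc znew_def by blast
  then show ?case
  proof cases
    case Keep
    then show ?thesis using Suc.prems(2,3) Suc.IH by (auto simp: zwalk_into_Keep)
  next
    case Copy
    then show ?thesis using Suc.prems(2,3) Suc.IH by (auto simp: zwalk_into_Copy)
  next
    case Apex
    show ?thesis
    proof (cases "x = y")
      case True
      then have "m = 0" "n = 0"
        using Suc.prems(2,3) Apex(1) by (cases m; cases n; auto simp: zwalk_into_Apex simp del: relpow.simps(2))+
      then show ?thesis by simp
    next
      case False
      then obtain a b where ab: "m = Suc a" "n = Suc b"
        using Suc.prems(2,3) by (cases m; cases n) auto
      then obtain t t' x' where t: "t \<in> set T" "t' \<in> set T" "(x', t) \<in> zarc ^^ a" "(x', t') \<in> zarc ^^ b"
        using Suc.prems(2,3) unfolding Apex(1) ab zwalk_into_Apex by auto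
      then have "t = t'" using transversal_disjoint[OF Apex(2)] by blast
      moreover have "t \<in> zverts k" using t(1) transversal_subset[OF Apex(2)] by blast
      ultimately show ?thesis using Suc.IH t(3,4) ab by blast
    qed
  qed
qed simp

text \<open>A proper colouring of the digraph after \<open>k\<close> steps with the colours \<open>{..<k}\<close>, increasing
  along arcs.\<close>

primrec layer :: "zvertex \<Rightarrow> nat" where
  "layer (Keep x) = layer x"
| "layer (Copy x) = layer x"
| "layer (Apex T) = length T"

lemma layer_less: "x \<in> zverts k \<Longrightarrow> layer x < k"
  by (induction k arbitrary: x) (auto simp: zverts_Suc znew_def length_transversal intro: less_SucI)

lemma layer_zarc: "(x, y) \<in> zarc \<Longrightarrow> y \<in> zverts k \<Longrightarrow> layer x < layer y"
proof (induction k arbitrary: x y)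
  case (Suc k)
  from Suc.prems(2) consider
      (Keep) z where "y = Keep z" "z \<in> zverts k"
    | (Copy) z where "y = Copy z" "z \<in> zverts k"
    | (Apex) T where "y = Apex T" "T \<in> transversals k"
    unfolding zverts_Suc znew_def by blast
  then show ?case
  proof cases
    case Apex
    then obtain t where "x = Copy t" "t \<in> zverts k"
      using Suc.prems(1) transversal_subset[OF Apex(2)] by (auto simp: zarc_into_Apex)
    then show ?thesis using layer_less[of t k] length_transversal[OF Apex(2)] Apex(1) by simp
  qed (use Suc in \<open>auto simp: zarc_into_Keep zarc_into_Copy\<close>)
qed simp

text \<open>Let \<open>S\<close> be rainbow in the \<open>Keep\<close> copy and \<open>T\<close> in the \<open>Copy\<close> copy, each with \<open>k\<close>
  elements. Together with \<open>Apex T\<close>, the copy of \<open>T\<close> shows \<open>k + 1\<close> colours, so one of these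
  vertices has a colour that is missing on \<open>S\<close>, and it extends \<open>S\<close> to a rainbow transversal.\<close>

lemma rainbow_transversal:
  assumes "\<And>x y. (x, y) \<in> zarc \<Longrightarrow> y \<in> zverts k \<Longrightarrow> c x \<noteq> c y"
  shows "\<exists>T\<in>transversals k. distinct (map c T)"
  using assms
proof (induction k arbitrary: c)
  case (Suc k)
  have "\<exists>T\<in>transversals k. distinct (map (c \<circ> Keep) T)"
    by (rule Suc.IH) (use Suc.prems in \<open>auto simp: zverts_Suc intro: zarc.intros\<close>)
  then obtain S where S: "S \<in> transversals k" "distinct (map (c \<circ> Keep) S)" by blast
  have "\<exists>T\<in>transversals k. distinct (map (c \<circ> Copy) T)"
    by (rule Suc.IH) (use Suc.prems in \<open>auto simp: zverts_Suc znew_def intro: zarc.intros\<close>)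
  then obtain T where T: "T \<in> transversals k" "distinct (map (c \<circ> Copy) T)" by blast
  let ?Y = "Apex T # map Copy T"
  have "c (Copy t) \<noteq> c (Apex T)" if "t \<in> set T" for t
    using that T(1) by (intro Suc.prems) (auto simp: zverts_Suc znew_def intro: zarc.intros)
  then have "distinct (map c ?Y)" using T(2) by force
  then have "card (set (map c ?Y)) = length (map c ?Y)" by (rule distinct_card)
  then have "card (c ` set ?Y) = Suc k"
    unfolding set_map using length_transversal[OF T(1)] by simp
  moreover have "card (c ` Keep ` set S) \<le> k"
    using card_length[of "map (c \<circ> Keep) S"] length_transversal[OF S(1)] by (simp add: image_comp)
  ultimately have "\<not> c ` set ?Y \<subseteq> c ` Keep ` set S"
    by (metis List.finite_set card_mono finite_imageI not_less_eq_eq order_trans)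
  then obtain y where y: "y \<in> set ?Y" "c y \<notin> c ` Keep ` set S" by blast
  have "y \<in> znew k" using y(1) T(1) transversal_subset[OF T(1)] unfolding znew_def by auto
  then have "y # map Keep S \<in> transversals (Suc k)"
    unfolding transversals_Suc using S(1) by force
  moreover have "distinct (map c (y # map Keep S))" using S(2) y(2) by (simp add: image_comp comp_def)
  ultimately show ?case by blast
qed simp

lemma long_zwalk: "\<exists>T\<in>transversals (Suc k). \<exists>x. (x, hd T) \<in> zarc ^^ k"
proof (induction k)
  case 0
  then show ?case using transversals_nonempty by auto
next
  case (Suc k)
  then obtain T x where T: "T \<in> transversals (Suc k)" "(x, hd T) \<in> zarc ^^ k" by blast
  have "hd T \<in> set T" using length_transversal[OF T(1)] by (cases T) auto
  then have "(Copy x, Apex T) \<in> zarc ^^ Suc k"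
    using T(2) unfolding zwalk_into_Apex by blast
  moreover have "Apex T # map Keep T \<in> transversals (Suc (Suc k))"
    unfolding transversals_Suc[of "Suc k"] using T(1) unfolding znew_def by force
  ultimately show ?case by (intro bexI exI) simp_all
qed

section \<open>Encoding a finite relation as a graph on natural numbers\<close>

text \<open>The graph with vertex set \<open>V\<close> and adjacency \<open>R\<close>, with its vertices encoded as natural
  numbers and each arc given as the pair of its endpoints.\<close>

definition graph_of :: "'a::countable set \<Rightarrow> ('a \<Rightarrow> 'a \<Rightarrow> bool) \<Rightarrow> (nat, nat \<times> nat) pre_digraph" where
  "graph_of V R = \<lparr>verts = to_nat ` V,
     arcs = {(to_nat x, to_nat y) | x y. x \<in> V \<and> y \<in> V \<and> R x y}, tail = fst, head = snd\<rparr>"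

lemma graph_of_sel [simp]:
  "verts (graph_of V R) = to_nat ` V"
  "arcs (graph_of V R) = {(to_nat x, to_nat y) | x y. x \<in> V \<and> y \<in> V \<and> R x y}"
  "tail (graph_of V R) = fst" "head (graph_of V R) = snd"
  by (simp_all add: graph_of_def)

lemma dominates_graph_of [simp]:
  "to_nat x \<rightarrow>\<^bsub>graph_of V R\<^esub> to_nat y \<longleftrightarrow> x \<in> V \<and> y \<in> V \<and> R x y"
  unfolding arcs_ends_conv by force

lemma graph_graph_of:
  assumes "finite V" "\<And>x y. R x y \<Longrightarrow> R y x" "\<And>x. \<not> R x x"
  shows "graph (graph_of V R)"
proof
  have "arcs (graph_of V R) \<subseteq> to_nat ` V \<times> to_nat ` V" by auto
  then show "finite (arcs (graph_of V R))"
    using assms(1) by (meson finite_SigmaI finite_imageI finite_subset)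
  show "symmetric (graph_of V R)"
    unfolding symmetric_conv using assms(2) by fastforce
qed (use assms in \<open>auto simp: arc_to_ends_def\<close>)

lemma induced_subgraph_graph_of:
  assumes "induced_subgraph H (graph_of V R)"
  obtains U where "U \<subseteq> V" "H = graph_of U R"
proof -
  have sub: "verts H \<subseteq> to_nat ` V" and th: "tail H = fst" "head H = snd"
    and arcs: "arcs H = {e \<in> arcs (graph_of V R). fst e \<in> verts H \<and> snd e \<in> verts H}"
    using assms unfolding induced_subgraph_def subgraph_def compatible_def by auto
  define U where "U = {x \<in> V. to_nat x \<in> verts H}"
  have verts: "verts H = to_nat ` U" using sub unfolding U_def by auto
  have "arcs H = {(to_nat x, to_nat y) | x y. x \<in> U \<and> y \<in> U \<and> R x y}"
    unfolding arcs U_def by auto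
  then have "H = graph_of U R" using verts th by simp
  moreover have "U \<subseteq> V" unfolding U_def by blast
  ultimately show ?thesis using that by blast
qed

lemma is_clique_graph_of:
  "is_clique (graph_of V R) C \<longleftrightarrow> (\<exists>K\<subseteq>V. C = to_nat ` K \<and> pairwise R K)"
proof
  assume C: "is_clique (graph_of V R) C"
  then obtain K where K: "K \<subseteq> V" "C = to_nat ` K"
    unfolding is_clique_def graph_of_sel(1) by (meson subset_imageE)
  have "pairwise R K"
  proof (rule pairwiseI)
    fix x y assume "x \<in> K" "y \<in> K" "x \<noteq> y"
    then have "to_nat x \<rightarrow>\<^bsub>graph_of V R\<^esub> to_nat y"
      using C unfolding is_clique_def K(2) by auto
    then show "R x y" by simp
  qed
  then show "\<exists>K\<subseteq>V. C = to_nat ` K \<and> pairwise R K" using K by blast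
qed (auto simp: is_clique_def pairwise_def)

lemma clique_number_graph_of:
  "clique_number (graph_of V R) = Max {card K | K. K \<subseteq> V \<and> pairwise R K}"
proof -
  have "card (to_nat ` K) = card K" for K :: "'a set"
    by (rule card_image) simp
  then have "{card C | C. is_clique (graph_of V R) C} = {card K | K. K \<subseteq> V \<and> pairwise R K}"
    unfolding is_clique_graph_of by (auto, metis)
  then show ?thesis unfolding clique_number_def by simp
qed

lemma finite_clique_cards: "finite V \<Longrightarrow> finite {card K | K. K \<subseteq> V \<and> pairwise R K}"
  by (rule finite_subset[of _ "card ` Pow V"]) auto

lemma ex_proper_colouring_graph_of:
  "(\<exists>c. proper_colouring (graph_of V R) n c) \<longleftrightarrow>
     (\<exists>c. (\<forall>v\<in>V. c v < n) \<and> (\<forall>u\<in>V. \<forall>v\<in>V. R u v \<longrightarrow> c u \<noteq> c v))"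
proof
  assume "\<exists>c. proper_colouring (graph_of V R) n c"
  then obtain c where "proper_colouring (graph_of V R) n c" by blast
  then show "\<exists>c. (\<forall>v\<in>V. c v < n) \<and> (\<forall>u\<in>V. \<forall>v\<in>V. R u v \<longrightarrow> c u \<noteq> c v)"
    unfolding proper_colouring_def by (intro exI[of _ "c \<circ> to_nat"]) auto
next
  assume "\<exists>c. (\<forall>v\<in>V. c v < n) \<and> (\<forall>u\<in>V. \<forall>v\<in>V. R u v \<longrightarrow> c u \<noteq> c v)"
  then obtain c where "\<forall>v\<in>V. c v < n" "\<forall>u\<in>V. \<forall>v\<in>V. R u v \<longrightarrow> c u \<noteq> c v" by blast
  then have "proper_colouring (graph_of V R) n (c \<circ> from_nat)"
    unfolding proper_colouring_def by auto
  then show "\<exists>c. proper_colouring (graph_of V R) n c" by blast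
qed

section \<open>The graph\<close>

text \<open>The digraph after \<open>k\<close> steps. Restricting the heads of the arcs restricts the tails as well,
  by \<open>zverts_closed\<close>.\<close>

definition zykov :: "nat \<Rightarrow> zvertex rel" where
  "zykov k = {(x, y) \<in> zarc. y \<in> zverts k}"

lemma zykov_walk_iff:
  assumes "y \<in> zverts k"
  shows "(x, y) \<in> zykov k ^^ n \<longleftrightarrow> (x, y) \<in> zarc ^^ n"
  using assms
proof (induction n arbitrary: y)
  case (Suc n)
  have "(x, y) \<in> zykov k ^^ Suc n \<longleftrightarrow> (\<exists>z. (x, z) \<in> zykov k ^^ n \<and> (z, y) \<in> zarc)"
    using Suc.prems by (auto simp: zykov_def)
  also have "\<dots> \<longleftrightarrow> (\<exists>z. (x, z) \<in> zarc ^^ n \<and> (z, y) \<in> zarc)"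
    using Suc.IH zverts_closed[OF _ Suc.prems] by blast
  finally show ?case by auto
qed simp

interpretation zykov: walk_length "zykov k" for k
proof
  fix x y m n assume m: "(x, y) \<in> zykov k ^^ m" and n: "(x, y) \<in> zykov k ^^ n"
  show "m = n"
  proof (cases "y \<in> zverts k")
    case True
    then show ?thesis using zwalk_unique m n zykov_walk_iff by blast
  next
    case False
    then have "l = 0" if "(x, y) \<in> zykov k ^^ l" for l
      using that by (cases l) (auto simp: zykov_def)
    then show ?thesis using m n by blast
  qed
qed

lemma layer_zykov_walk:
  assumes "(x, y) \<in> zykov k ^^ n" "n > 0"
  shows "layer x < layer y"
proof -
  have "(x, y) \<in> (zykov k)\<^sup>+" using assms unfolding trancl_power by blast
  then show ?thesis
    by (induction rule: trancl_induct) (auto simp: zykov_def dest: layer_zarc)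
qed

lemma zykov_clique:
  assumes "p > 0" "p \<le> k"
  obtains K where "K \<subseteq> zverts k" "card K = p" "pairwise (zykov.adj k p) K"
proof -
  obtain k' where k': "k = Suc k'" using assms by (cases k) auto
  obtain T x where T: "T \<in> transversals k" "(x, hd T) \<in> zarc ^^ k'"
    using long_zwalk k' by blast
  let ?y = "hd T"
  have "?y \<in> set T" using length_transversal[OF T(1)] k' by (cases T) auto
  then have y: "?y \<in> zverts k" using transversal_subset[OF T(1)] by blast
  have "(x, ?y) \<in> zykov k ^^ k'"
    using T(2) unfolding zykov_walk_iff[OF y] .
  moreover have "k' = (k' - (p - 1)) + (p - 1)" using assms k' by simp
  ultimately have "(x, ?y) \<in> zykov k ^^ ((k' - (p - 1)) + (p - 1))" by simp
  then obtain z where "(z, ?y) \<in> zykov k ^^ (p - 1)"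
    unfolding relpow_add by blast
  then obtain K where K: "card K = p" "pairwise (zykov.adj k p) K"
      "\<forall>z\<in>K. (z, ?y) \<in> (zykov k)\<^sup>*"
    using zykov.walk_clique assms(1) by metis
  have "z \<in> zverts k" if "(z, ?y) \<in> (zykov k)\<^sup>*" for z
    using that y
    by (induction rule: converse_rtrancl_induct) (auto simp: zykov_def dest: zverts_closed)
  then show ?thesis using that[of K] K by blast
qed

theorem theorem3:
  fixes p k :: nat
  assumes "prime p" and "k \<ge> p"
  shows "\<exists>G :: (nat, nat \<times> nat) pre_digraph.
           graph G \<and> clique_number G = p \<and> chromatic_number G = k \<and>
           (\<forall>H m. induced_subgraph H G \<and> clique_number H = m \<and> m < p \<longrightarrow>
                  chromatic_number H \<le> (m + 2) choose 3)"
proof -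
  let ?R = "zykov.adj k p" and ?V = "zverts k"
  let ?G = "graph_of ?V ?R"
  have p: "p > 1" using assms(1) by (rule prime_gt_1_nat)
  have "graph ?G"
    using finite_zverts zykov.adj_sym zykov.adj_irrefl by (intro graph_graph_of) blast+
  moreover have "clique_number ?G = p"
    unfolding clique_number_graph_of
  proof (rule Max_eqI)
    show "finite {card K | K. K \<subseteq> ?V \<and> pairwise ?R K}"
      using finite_clique_cards finite_zverts by blast
    show "n \<le> p" if "n \<in> {card K | K. K \<subseteq> ?V \<and> pairwise ?R K}" for n
      using that zykov.card_clique_le finite_subset[OF _ finite_zverts] p by auto
    show "p \<in> {card K | K. K \<subseteq> ?V \<and> pairwise ?R K}"
    proof -
      obtain K where "K \<subseteq> ?V" "card K = p" "pairwise ?R K"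
        using zykov_clique[of p k] p assms(2) by auto
      then show ?thesis by blast
    qed
  qed
  moreover have "chromatic_number ?G = k"
    unfolding chromatic_number_def ex_proper_colouring_graph_of
  proof (rule Least_equality)
    have "layer x \<noteq> layer y" if R: "?R x y" for x y
    proof -
      obtain n where n: "\<not> p dvd n" "(x, y) \<in> zykov k ^^ n \<or> (y, x) \<in> zykov k ^^ n"
        using R unfolding zykov.adj_def by blast
      moreover have "n > 0" using n(1) by (cases n) auto
      ultimately show ?thesis using layer_zykov_walk by (metis less_irrefl)
    qed
    then show "\<exists>c. (\<forall>v\<in>?V. c v < k) \<and> (\<forall>u\<in>?V. \<forall>v\<in>?V. ?R u v \<longrightarrow> c u \<noteq> c v)"
      using layer_less by blast
  next
    fix n :: nat assume "\<exists>c. (\<forall>v\<in>?V. c v < n) \<and> (\<forall>u\<in>?V. \<forall>v\<in>?V. ?R u v \<longrightarrow> c u \<noteq> c v)"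
    then obtain c :: "zvertex \<Rightarrow> nat" where c: "\<And>v. v \<in> ?V \<Longrightarrow> c v < n"
      "\<And>u v. u \<in> ?V \<Longrightarrow> v \<in> ?V \<Longrightarrow> ?R u v \<Longrightarrow> c u \<noteq> c v" by blast
    have "c x \<noteq> c y" if "(x, y) \<in> zarc" "y \<in> ?V" for x y
    proof (rule c(2))
      have "(x, y) \<in> zykov k ^^ 1" using that by (simp add: zykov_def)
      then show "?R x y" unfolding zykov.adj_def using p by (intro exI[of _ 1]) simp
    qed (use that zverts_closed in blast)+
    then obtain T where T: "T \<in> transversals k" "distinct (map c T)"
      using rainbow_transversal by blast
    have "k = card (set (map c T))"
      using distinct_card[OF T(2)] length_transversal[OF T(1)] by simp
    also have "\<dots> \<le> card {..<n}"
      using c(1) transversal_subset[OF T(1)] by (intro card_mono) auto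
    finally show "k \<le> n" by simp
  qed
  moreover have "chromatic_number H \<le> (m + 2) choose 3"
    if H: "induced_subgraph H ?G" and m: "clique_number H = m" "m < p" for H m
  proof -
    obtain U where U: "U \<subseteq> ?V" "H = graph_of U ?R"
      using induced_subgraph_graph_of[OF H] by blast
    have fin: "finite U" using U(1) finite_zverts finite_subset by blast
    have "card K \<le> m" if "K \<subseteq> U" "pairwise ?R K" for K
      using that m(1) Max_ge[OF finite_clique_cards[OF fin, of ?R]]
      unfolding U(2) clique_number_graph_of by blast
    then obtain c :: "zvertex \<Rightarrow> nat" where "\<And>v. v \<in> U \<Longrightarrow> c v < (m + 2) choose 3"
      "\<And>u v. u \<in> U \<Longrightarrow> v \<in> U \<Longrightarrow> ?R u v \<Longrightarrow> c u \<noteq> c v"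
      using zykov.colouring_of_small_clique_number[OF assms(1) m(2) fin] by metis
    then show ?thesis
      unfolding chromatic_number_def U(2) ex_proper_colouring_graph_of
      by (intro Least_le) blast
  qed
  ultimately show ?thesis by blast
qed

end
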